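(* For any nonnegative integer $n$, \[ F_0(n) = \frac{\overline{p}(n)+\overline{p}\left(\frac{n}{2}\right)}{2} \qquad\text{and}\qquad F_1(n) = \frac{\overline{p}(n)-\overline{p}\left(\frac{n}{2}\right)}{2}. \]
   Context: A two-color partition of $n$ is a finite multiset of positive integers (parts), each part colored red or blue, whose sum is $n$ (the same integer in two different colors counts as two different kinds of parts). For a nonnegative integer $n$, $\mathcal{F}(n)$ is the set of two-color partitions of $n$ in which even parts may occur only in blue color (odd parts may occur in either color; repetitions are allowed). $F_0(n)$ (resp. $F_1(n)$) is the number of partitions in $\mathcal{F}(n)$ in which the number of red odd parts (counted with multiplicity) is even (resp. odd). $\overline{p}(n)$ is the number of overpartitions of $n$, i.e. partitions of $n$ in which the first occurrence of each part size may be overlined (so $\overline{p}(0)=1$); by convention $\overline{p}(k)=0$ if $k$ is not a nonnegative integer. *)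

theory Defs
  imports Complex_Main "HOL-Library.Multiset"
begin

datatype color = Red | Blue

definition two_color_partitions :: "nat \<Rightarrow> (nat \<times> color) multiset set" where
  "two_color_partitions n =
     {P. (\<forall>(k, c) \<in> set_mset P. 0 < k) \<and> (\<Sum>(k, c) \<in># P. k) = n}"

definition \<F> :: "nat \<Rightarrow> (nat \<times> color) multiset set" where
  "\<F> n = {P \<in> two_color_partitions n. \<forall>(k, c) \<in> set_mset P. even k \<longrightarrow> c = Blue}"

definition red_odd_parts :: "(nat \<times> color) multiset \<Rightarrow> nat" where
  "red_odd_parts P = size {#(k, c) \<in># P. odd k \<and> c = Red#}"

definition F\<^sub>0 :: "nat \<Rightarrow> nat" where
  "F\<^sub>0 n = card {P \<in> \<F> n. even (red_odd_parts P)}"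

definition F\<^sub>1 :: "nat \<Rightarrow> nat" where
  "F\<^sub>1 n = card {P \<in> \<F> n. odd (red_odd_parts P)}"

text \<open>An overpartition is a partition \<open>P\<close> together with the set \<open>S\<close> of those part sizes of \<open>P\<close>
  whose first occurrence is overlined.\<close>

definition overpartitions :: "nat \<Rightarrow> (nat multiset \<times> nat set) set" where
  "overpartitions n =
     {(P, S). (\<forall>k \<in> set_mset P. 0 < k) \<and> sum_mset P = n \<and> S \<subseteq> set_mset P}"

text \<open>The argument is rational so that the convention \<open>overp k = 0\<close> for \<open>k\<close> not a
  nonnegative integer makes sense.\<close>

definition overp :: "rat \<Rightarrow> nat" where
  "overp x = (if x \<in> \<nat> then card (overpartitions (nat \<lfloor>x\<rfloor>)) else 0)"

end

theory Submission
  imports Defs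
begin

text \<open>
  A partition in \<open>\<F> n\<close> is a pair \<open>(B, R)\<close>: the blue parts \<open>B\<close>, arbitrary, and the red parts \<open>R\<close>,
  all odd. An overpartition is likewise a pair: its non-overlined parts, arbitrary, and its
  overlined parts, which are distinct. By Euler's theorem
  (\<open>card_odd_partitions_eq_distinct\<close>) there are as many partitions of \<open>m\<close> into odd parts as into
  distinct parts, so \<open>F\<^sub>0 n + F\<^sub>1 n\<close> is the number of overpartitions of \<open>n\<close>
  (\<open>card_overpartitions\<close>).

  The difference \<open>F\<^sub>0 n - F\<^sub>1 n\<close> counts \<open>\<F> n\<close> with the sign \<open>(-1)\<close> to the number of red
  parts. Changing the colour of one odd part reverses the sign. This can be done
  involutively at the smallest odd size that occurs in blue or occurs in red with odd
  multiplicity (\<open>recolor\<close>): an odd red multiplicity loses one copy to blue, an even one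
  gains one from blue. The pairs for which no such size exists survive the cancellation. In them
  all blue parts are even and all red multiplicities are even, so the number of red parts is
  even, and halving the blue parts and the red multiplicities turns them into the pairs
  for \<open>n / 2\<close> (\<open>card_paired\<close>). There are none if \<open>n\<close> is odd, and otherwise their number is, by
  the formula for the sum again, the number of overpartitions of \<open>n / 2\<close>.
\<close>

section \<open>Partitions with prescribed parts\<close>

definition partitions_into :: "nat set \<Rightarrow> nat \<Rightarrow> nat multiset set" where
  "partitions_into A m = {M. set_mset M \<subseteq> A \<and> sum_mset M = m}"

definition distinct_partitions :: "nat \<Rightarrow> nat set set" where
  "distinct_partitions m = {S. finite S \<and> S \<subseteq> {0<..} \<and> \<Sum>S = m}"

lemma size_le_sum_mset:
  fixes M :: "nat multiset"
  assumes "set_mset M \<subseteq> {0<..}"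
  shows "size M \<le> sum_mset M"
  using assms by (induction M) auto

lemma finite_partitions_into:
  assumes "A \<subseteq> {0<..}"
  shows "finite (partitions_into A m)"
proof (rule finite_subset)
  show "partitions_into A m \<subseteq> (\<Union>s\<le>m. multisets_of_size {..m} s)"
  proof
    fix M assume M: "M \<in> partitions_into A m"
    then have "size M \<le> m"
      using size_le_sum_mset[of M] assms by (auto simp: partitions_into_def)
    moreover have "k \<le> m" if "k \<in># M" for k
      using M that sum_mset.remove[of k M] by (auto simp: partitions_into_def)
    ultimately show "M \<in> (\<Union>s\<le>m. multisets_of_size {..m} s)"
      by (auto simp: multisets_of_size_def)
  qed
qed auto

lemma finite_distinct_partitions: "finite (distinct_partitions m)"
proof (rule finite_subset)
  show "distinct_partitions m \<subseteq> Pow {..m}"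
    by (auto simp: distinct_partitions_def intro: member_le_sum[of _ _ "\<lambda>k. k", simplified])
qed auto

lemma sum_mset_repeat_mset: "sum_mset (repeat_mset c M) = c * sum_mset (M :: nat multiset)"
  by (induction M) (simp_all add: sum_mset_replicate_mset distrib_left)

lemma set_mset_double: "set_mset (repeat_mset 2 M) = set_mset M"
  by (auto simp flip: count_greater_zero_iff)

lemma sum_mset_mset_set: "sum_mset (mset_set S) = \<Sum>S"
  by (simp add: sum_unfold_sum_mset)

section \<open>Odd parts and distinct parts\<close>

text \<open>Division with remainder by \<open>2\<close> on the multiplicities of a multiset: \<open>T\<close> collects the
  remainders \<open>1\<close> and \<open>Q\<close> the quotients. Together with its uniqueness below it drives the
  recurrence for odd parts, and it recovers the half of a multiset with even multiplicities.\<close>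

lemma parity_splitting:
  "\<exists>T Q. finite T \<and> M = mset_set T + repeat_mset 2 Q"
proof (induction M)
  case empty
  have "{#} = mset_set {} + repeat_mset 2 {#}" by simp
  then show ?case by (metis finite.emptyI)
next
  case (add x M)
  then obtain T Q where TQ: "finite T" "M = mset_set T + repeat_mset 2 Q" by auto
  show ?case
  proof (cases "x \<in> T")
    case True
    have "add_mset x M = mset_set (T - {x}) + repeat_mset 2 (add_mset x Q)"
      using TQ(2) mset_set.remove[OF TQ(1) True] by (simp add: numeral_2_eq_2)
    then show ?thesis using TQ(1) by (meson finite_Diff)
  next
    case False
    have "add_mset x M = mset_set (insert x T) + repeat_mset 2 Q"
      using TQ False by simp
    then show ?thesis using TQ(1) by (meson finite_insert)
  qed
qed

lemma odd_count_parity_splitting: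
  assumes "finite T"
  shows "{x. odd (count (mset_set T + repeat_mset 2 Q) x)} = T"
  using assms by (auto simp: count_mset_set')

lemma parity_splitting_unique:
  assumes "finite T" "finite T'"
    and "mset_set T + repeat_mset 2 Q = mset_set T' + repeat_mset 2 Q'"
  shows "T = T' \<and> Q = Q'"
proof -
  have "T = T'"
    using odd_count_parity_splitting assms by metis
  then show ?thesis using assms(3) repeat_mset_cancel1[of 2 Q Q'] by simp
qed

text \<open>The candidates for two sets: the parts of odd multiplicity in a partition of \<open>m\<close> into odd
  parts, and the odd parts of a partition of \<open>m\<close> into distinct parts. In both cases what
  remains has even sum, which is the last condition.\<close>

definition odd_skeletons :: "nat \<Rightarrow> nat set set" where
  "odd_skeletons m = {T. finite T \<and> T \<subseteq> Collect odd \<and> \<Sum>T \<le> m \<and> even (m - \<Sum>T)}"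

lemma finite_odd_skeletons: "finite (odd_skeletons m)"
proof (rule finite_subset)
  show "odd_skeletons m \<subseteq> Pow {..m}"
    using member_le_sum[of _ _ "\<lambda>k::nat. k"]
    by (fastforce simp: odd_skeletons_def)
qed auto

text \<open>Take one copy of each part of odd multiplicity; what remains comes in equal pairs, and one
  part of each pair is kept.\<close>

lemma odd_partitions_recurrence:
  "card (partitions_into (Collect odd) m) =
     (\<Sum>T\<in>odd_skeletons m. card (partitions_into (Collect odd) ((m - \<Sum>T) div 2)))"
proof -
  let ?O = "partitions_into (Collect odd)"
  let ?f = "\<lambda>(T, Q). mset_set T + repeat_mset 2 Q"
  let ?X = "SIGMA T:odd_skeletons m. ?O ((m - \<Sum>T) div 2)"
  have "bij_betw ?f ?X (?O m)"
    unfolding bij_betw_def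
  proof
    show "inj_on ?f ?X"
      by (rule inj_onI) (auto simp: odd_skeletons_def dest!: parity_splitting_unique[rotated 2])
    show "?f ` ?X = ?O m"
    proof
      show "?f ` ?X \<subseteq> ?O m"
        by (auto simp: odd_skeletons_def partitions_into_def sum_mset_repeat_mset
              set_mset_double sum_mset_mset_set)
    next
      show "?O m \<subseteq> ?f ` ?X"
      proof
        fix M assume M: "M \<in> ?O m"
        obtain T Q where TQ: "finite T" "M = mset_set T + repeat_mset 2 Q"
          using parity_splitting by blast
        have "\<Sum>T + 2 * sum_mset Q = m"
          using M TQ by (simp add: partitions_into_def sum_mset_repeat_mset sum_mset_mset_set)
        then have "(T, Q) \<in> ?X"
          using M TQ by (auto simp: odd_skeletons_def partitions_into_def set_mset_double)
        then show "M \<in> ?f ` ?X" using TQ by force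
      qed
    qed
  qed
  then have "card (?O m) = card ?X" by (simp add: bij_betw_same_card)
  also have "\<dots> = (\<Sum>T\<in>odd_skeletons m. card (?O ((m - \<Sum>T) div 2)))"
    by (intro card_SigmaI) (auto intro: finite_odd_skeletons finite_partitions_into odd_pos)
  finally show ?thesis .
qed

text \<open>Here the odd parts are set aside, and the remaining parts are even and are halved. The result
  is the same recurrence as for odd parts, from which Euler's theorem follows by induction.\<close>

lemma distinct_partitions_recurrence:
  "card (distinct_partitions m) =
     (\<Sum>T\<in>odd_skeletons m. card (distinct_partitions ((m - \<Sum>T) div 2)))"
proof -
  let ?D = distinct_partitions
  let ?f = "\<lambda>(T, S). T \<union> (*) 2 ` S"
  let ?X = "SIGMA T:odd_skeletons m. ?D ((m - \<Sum>T) div 2)"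
  have sum_f: "\<Sum>(T \<union> (*) 2 ` S) = \<Sum>T + 2 * \<Sum>S"
    if "finite T" "T \<subseteq> Collect odd" "finite S" for T S :: "nat set"
  proof -
    have "\<Sum>(T \<union> (*) 2 ` S) = \<Sum>T + \<Sum>((*) 2 ` S)"
      using that by (intro sum.union_disjoint) auto
    also have "\<Sum>((*) 2 ` S) = 2 * \<Sum>S"
      by (subst sum.reindex) (auto simp: inj_on_def sum_distrib_left)
    finally show ?thesis .
  qed
  have parts: "{k \<in> T \<union> (*) 2 ` S. odd k} = T" "{k. 2 * k \<in> T \<union> (*) 2 ` S} = S"
    if "T \<subseteq> Collect odd" for T S :: "nat set"
    using that by force+
  have "bij_betw ?f ?X (?D m)"
  proof (rule bij_betw_byWitness[where f' = "\<lambda>S. ({k\<in>S. odd k}, {k. 2 * k \<in> S})"])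
    show "\<forall>a\<in>?X. (\<lambda>S. ({k\<in>S. odd k}, {k. 2 * k \<in> S})) (?f a) = a"
    proof
      fix a assume "a \<in> ?X"
      then obtain T S where "a = (T, S)" "T \<subseteq> Collect odd"
        by (auto simp: odd_skeletons_def)
      then show "(\<lambda>S. ({k\<in>S. odd k}, {k. 2 * k \<in> S})) (?f a) = a"
        by (simp only: prod.case parts)
    qed
    show recompose: "\<forall>S\<in>?D m. ?f ({k\<in>S. odd k}, {k. 2 * k \<in> S}) = S"
    proof
      fix S assume "S \<in> ?D m"
      have "k \<in> (*) 2 ` {k. 2 * k \<in> S}" if "k \<in> S" "even k" for k
        using that by (intro image_eqI[of _ _ "k div 2"]) auto
      then show "?f ({k\<in>S. odd k}, {k. 2 * k \<in> S}) = S" by auto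
    qed
    show "?f ` ?X \<subseteq> ?D m"
    proof clarify
      fix T S assume TS: "T \<in> odd_skeletons m" "S \<in> ?D ((m - \<Sum>T) div 2)"
      then have "finite T" "T \<subseteq> Collect odd" "finite S" "S \<subseteq> {0<..}"
        and "\<Sum>T + 2 * \<Sum>S = m"
        by (auto simp: odd_skeletons_def distinct_partitions_def)
      moreover have "T \<subseteq> {0<..}"
        using \<open>T \<subseteq> Collect odd\<close> odd_pos by auto
      ultimately show "T \<union> (*) 2 ` S \<in> ?D m"
        by (auto simp: distinct_partitions_def sum_f)
    qed
    show "(\<lambda>S. ({k\<in>S. odd k}, {k. 2 * k \<in> S})) ` ?D m \<subseteq> ?X"
    proof clarify
      fix S assume S: "S \<in> ?D m"
      let ?T = "{k\<in>S. odd k}" and ?H = "{k. 2 * k \<in> S}"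
      have "finite ?H"
        using S finite_vimageI[of S "(*) 2"]
        by (simp add: distinct_partitions_def vimage_def inj_on_def)
      moreover have "\<Sum>?T + 2 * \<Sum>?H = m"
      proof -
        have "\<Sum>(?T \<union> (*) 2 ` ?H) = \<Sum>?T + 2 * \<Sum>?H"
          using S \<open>finite ?H\<close> by (intro sum_f) (auto simp: distinct_partitions_def)
        moreover have "?T \<union> (*) 2 ` ?H = S" using bspec[OF recompose S] by simp
        ultimately show ?thesis using S by (simp add: distinct_partitions_def)
      qed
      moreover have "?H \<subseteq> {0<..}" "finite ?T"
        using S by (auto simp: distinct_partitions_def)
      ultimately show "?T \<in> odd_skeletons m \<and> ?H \<in> ?D ((m - \<Sum>?T) div 2)"
        unfolding odd_skeletons_def distinct_partitions_def by auto
    qed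
  qed
  then have "card (?D m) = card ?X" by (simp add: bij_betw_same_card)
  also have "\<dots> = (\<Sum>T\<in>odd_skeletons m. card (?D ((m - \<Sum>T) div 2)))"
    by (intro card_SigmaI) (auto intro: finite_odd_skeletons finite_distinct_partitions)
  finally show ?thesis .
qed

theorem card_odd_partitions_eq_distinct:
  "card (partitions_into (Collect odd) m) = card (distinct_partitions m)"
proof (induction m rule: less_induct)
  case (less m)
  show ?case
  proof (cases "m = 0")
    case True
    have "partitions_into (Collect odd) 0 = {{#}}"
    proof (intro set_eqI iffI)
      fix M assume "M \<in> partitions_into (Collect odd) 0"
      then show "M \<in> {{#}}" by (cases M) (auto simp: partitions_into_def)
    qed (simp add: partitions_into_def)
    moreover have "distinct_partitions 0 = {{}}"
      by (fastforce simp: distinct_partitions_def)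
    ultimately show ?thesis using True by simp
  next
    case False
    \<comment> \<open>Only \<open>m = 0\<close> recurs to itself, through the empty skeleton.\<close>
    then have "(m - \<Sum>T) div 2 < m" for T :: "nat set" by linarith
    then show ?thesis
      unfolding odd_partitions_recurrence[of m] distinct_partitions_recurrence[of m]
      by (intro sum.cong refl less.IH)
  qed
qed

section \<open>Two-colour partitions and overpartitions\<close>

definition blue_red :: "nat \<Rightarrow> (nat multiset \<times> nat multiset) set" where
  "blue_red n = {(B, R). set_mset B \<subseteq> {0<..} \<and> set_mset R \<subseteq> Collect odd
                         \<and> sum_mset B + sum_mset R = n}"

definition merge_colors :: "nat multiset \<times> nat multiset \<Rightarrow> (nat \<times> color) multiset" where
  "merge_colors = (\<lambda>(B, R). image_mset (\<lambda>k. (k, Blue)) B + image_mset (\<lambda>k. (k, Red)) R)"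

definition of_color :: "color \<Rightarrow> (nat \<times> color) multiset \<Rightarrow> nat multiset" where
  "of_color c P = image_mset fst {#x \<in># P. snd x = c#}"

lemma merge_colors_of_color: "merge_colors (of_color Blue P, of_color Red P) = P"
proof (induction P)
  case (add x P)
  then show ?case
    by (cases x; cases "snd x") (auto simp: merge_colors_def of_color_def)
qed (simp add: merge_colors_def of_color_def)

lemma of_color_merge_colors:
  "of_color Blue (merge_colors (B, R)) = B" "of_color Red (merge_colors (B, R)) = R"
  by (simp_all add: merge_colors_def of_color_def filter_mset_image_mset multiset.map_comp o_def)

lemma merge_colors_in_F_iff: "merge_colors (B, R) \<in> \<F> n \<longleftrightarrow> (B, R) \<in> blue_red n"
  by (auto simp: merge_colors_def \<F>_def two_color_partitions_def blue_red_def
        multiset.map_comp o_def intro: odd_pos)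

lemma red_odd_parts_merge_colors:
  assumes "set_mset R \<subseteq> Collect odd"
  shows "red_odd_parts (merge_colors (B, R)) = size R"
proof -
  have "filter_mset odd R = R"
    using assms by (auto simp: filter_mset_eq_conv)
  then show ?thesis
    by (simp add: red_odd_parts_def merge_colors_def filter_mset_image_mset o_def)
qed

lemma bij_merge_colors: "bij merge_colors"
  by (rule bij_betw_byWitness[where f' = "\<lambda>P. (of_color Blue P, of_color Red P)"])
     (auto simp: merge_colors_of_color of_color_merge_colors)

lemma card_F_restricted:
  "card {P \<in> \<F> n. p (red_odd_parts P)} = card {x \<in> blue_red n. p (size (snd x))}"
proof -
  have red: "red_odd_parts (merge_colors x) = size (snd x)" if "x \<in> blue_red n" for x
    using that by (auto simp: blue_red_def red_odd_parts_merge_colors)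
  have mem: "merge_colors x \<in> \<F> n \<longleftrightarrow> x \<in> blue_red n" for x
    by (cases x) (simp add: merge_colors_in_F_iff)
  have "{P \<in> \<F> n. p (red_odd_parts P)} = merge_colors ` {x \<in> blue_red n. p (size (snd x))}"
  proof (intro set_eqI iffI)
    fix P assume P: "P \<in> {P \<in> \<F> n. p (red_odd_parts P)}"
    obtain x where x: "P = merge_colors x" using merge_colors_of_color[of P] by metis
    with P have "x \<in> blue_red n" by (simp add: mem)
    with P x have "x \<in> {x \<in> blue_red n. p (size (snd x))}" by (simp add: red)
    then show "P \<in> merge_colors ` {x \<in> blue_red n. p (size (snd x))}"
      unfolding x by (rule imageI)
  next
    fix P assume "P \<in> merge_colors ` {x \<in> blue_red n. p (size (snd x))}"
    then obtain x where "x \<in> blue_red n" "p (size (snd x))" "P = merge_colors x" by blast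
    then show "P \<in> {P \<in> \<F> n. p (red_odd_parts P)}" by (simp add: mem red)
  qed
  then show ?thesis
    by (simp add: card_image inj_on_subset[OF bij_is_inj[OF bij_merge_colors] subset_UNIV])
qed

lemma blue_red_Sigma:
  "blue_red n = (SIGMA B:(\<Union>b\<le>n. partitions_into {0<..} b).
                   partitions_into (Collect odd) (n - sum_mset B))"
  by (auto simp: blue_red_def partitions_into_def)

lemma finite_blue_red: "finite (blue_red n)"
  unfolding blue_red_Sigma
  by (intro finite_SigmaI finite_UN_I) (auto intro!: finite_partitions_into odd_pos)

text \<open>Removing the overlined parts leaves an arbitrary partition \<open>B\<close>. For fixed \<open>B\<close>, the overlined
  parts form a partition of \<open>n - sum_mset B\<close> into distinct parts, the red parts one into odd
  parts, and Euler's theorem compares the two fibres.\<close>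

lemma card_overpartitions: "card (overpartitions n) = card (blue_red n)"
proof -
  let ?I = "\<Union>b\<le>n. partitions_into {0<..} b"
  let ?X = "SIGMA B:?I. distinct_partitions (n - sum_mset B)"
  have fin: "finite ?I" by (auto intro: finite_partitions_into)
  have "bij_betw (\<lambda>(B, S). (B + mset_set S, S)) ?X (overpartitions n)"
  proof (rule bij_betw_byWitness[where f' = "\<lambda>(P, S). (P - mset_set S, S)"])
    have sub: "mset_set S \<subseteq># P" if "S \<subseteq> set_mset P" for P :: "nat multiset" and S
      using that by (metis finite_set_mset finite_subset msubset_mset_set_iff[of S "set_mset P"]
          mset_set_set_mset_msubset subset_mset.trans)
    show "\<forall>a\<in>overpartitions n. (\<lambda>(B, S). (B + mset_set S, S)) ((\<lambda>(P, S). (P - mset_set S, S)) a) = a"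
      by (auto simp: overpartitions_def sub)
    show "(\<lambda>(P, S). (P - mset_set S, S)) ` overpartitions n \<subseteq> ?X"
    proof clarify
      fix P S assume PS: "(P, S) \<in> overpartitions n"
      then have S: "S \<subseteq> set_mset P" "finite S"
        by (auto simp: overpartitions_def intro: finite_subset)
      have "sum_mset (P - mset_set S) + sum_mset (mset_set S) = sum_mset P"
        by (metis S(1) sub subset_mset.diff_add sum_mset.union)
      then have "sum_mset (P - mset_set S) + \<Sum>S = n"
        using PS by (simp add: overpartitions_def sum_mset_mset_set)
      then show "P - mset_set S \<in> ?I
          \<and> S \<in> distinct_partitions (n - sum_mset (P - mset_set S))"
        using PS S by (auto simp: overpartitions_def partitions_into_def distinct_partitions_def
            dest: in_diffD)
    qed
  qed (auto simp: overpartitions_def partitions_into_def distinct_partitions_def sum_mset_mset_set)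
  then have "card (overpartitions n) = card ?X" by (simp add: bij_betw_same_card)
  also have "\<dots> = card (blue_red n)"
    unfolding blue_red_Sigma using fin
    by (simp add: finite_distinct_partitions card_odd_partitions_eq_distinct
         finite_partitions_into[of "Collect odd"] subset_iff odd_pos)
  finally show ?thesis .
qed

section \<open>The parity of the number of red parts\<close>

text \<open>The odd sizes that obstruct halving.\<close>

definition unpaired :: "nat multiset \<times> nat multiset \<Rightarrow> nat set" where
  "unpaired = (\<lambda>(B, R). {k. odd k \<and> (k \<in># B \<or> odd (count R k))})"

text \<open>If no size is unpaired, \<open>Min\<close> is applied to the empty set and the value is meaningless;
  \<open>recolor\<close> is only used on pairs with an unpaired size.\<close>

definition recolor :: "nat multiset \<times> nat multiset \<Rightarrow> nat multiset \<times> nat multiset" where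
  "recolor = (\<lambda>(B, R). let k = Min (unpaired (B, R)) in
     if odd (count R k) then (add_mset k B, R - {#k#}) else (B - {#k#}, add_mset k R))"

text \<open>Recolouring a part of size \<open>k\<close> leaves \<open>k\<close> unpaired: either a blue \<open>k\<close> is created, or the
  red multiplicity of \<open>k\<close> becomes odd. Other sizes are not touched, so the set of unpaired sizes
  and its minimum persist, and a second recolouring acts on the same size in the opposite
  direction.\<close>

lemma recolor_properties:
  assumes x: "x \<in> blue_red n" "unpaired x \<noteq> {}"
  shows "recolor x \<in> blue_red n" "unpaired (recolor x) = unpaired x"
    "recolor (recolor x) = x" "even (size (snd (recolor x))) \<longleftrightarrow> odd (size (snd x))"
proof -
  obtain B R where BR: "x = (B, R)" by (cases x)
  define k where "k = Min (unpaired x)"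
  have "unpaired x \<subseteq> set_mset B \<union> set_mset R"
    by (auto simp: unpaired_def BR) (metis even_zero not_in_iff)
  then have "finite (unpaired x)" by (rule finite_subset) simp
  then have "k \<in> unpaired x" unfolding k_def using x(2) by (rule Min_in)
  then have k: "odd k" "k \<in># B \<or> odd (count R k)" by (auto simp: unpaired_def BR)
  have recolor_at: "recolor (B', R') =
      (if odd (count R' k) then (add_mset k B', R' - {#k#}) else (B' - {#k#}, add_mset k R'))"
    if "Min (unpaired (B', R')) = k" for B' R'
    using that by (simp add: recolor_def)
  have *: "recolor x = (add_mset k B, R - {#k#}) \<and> k \<in># R \<and> odd (count R k) \<or>
           recolor x = (B - {#k#}, add_mset k R) \<and> k \<in># B \<and> even (count R k)"
    using k recolor_at[of B R] by (auto simp: BR k_def simp flip: count_greater_zero_iff intro: odd_pos)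
  show un: "unpaired (recolor x) = unpaired x"
    using * k
    by (elim disjE conjE) (auto simp: unpaired_def BR in_diff_count split: if_splits)
  show "recolor x \<in> blue_red n"
    using * k x(1)
    by (elim disjE conjE)
       (auto simp: blue_red_def BR odd_pos dest: in_diffD dest!: multi_member_split)
  show "even (size (snd (recolor x))) \<longleftrightarrow> odd (size (snd x))"
    using * by (elim disjE conjE) (auto simp: BR dest!: multi_member_split)
  have min: "Min (unpaired (recolor x)) = k" by (simp add: un k_def)
  from * show "recolor (recolor x) = x"
  proof (elim disjE conjE)
    assume "recolor x = (add_mset k B, R - {#k#})" "k \<in># R" "odd (count R k)"
    then show ?thesis using min recolor_at by (simp add: BR)
  next
    assume "recolor x = (B - {#k#}, add_mset k R)" "k \<in># B" "even (count R k)"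
    then show ?thesis using min recolor_at by (simp add: BR)
  qed
qed

lemma card_unpaired_balanced:
  "card {x \<in> blue_red n. unpaired x \<noteq> {} \<and> even (size (snd x))} =
   card {x \<in> blue_red n. unpaired x \<noteq> {} \<and> odd (size (snd x))}"
  by (rule bij_betw_same_card[of recolor], rule bij_betw_byWitness[where f' = recolor])
     (simp_all add: image_subset_iff recolor_properties[where n = n] del: split_paired_All)

definition double :: "nat multiset \<times> nat multiset \<Rightarrow> nat multiset \<times> nat multiset" where
  "double = (\<lambda>(B, R). (image_mset ((*) 2) B, repeat_mset 2 R))"

lemma inj_double: "inj double"
proof -
  have "inj (image_mset ((*) (2::nat)))"
    by (rule multiset.inj_map) (simp add: inj_on_def)
  then show ?thesis
    by (auto simp: inj_on_def double_def repeat_mset_cancel1)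
qed

text \<open>Any even blue part is twice a blue part, whereas a red part must stay odd; so it is the
  multiplicities that are doubled in red, not the sizes.\<close>

lemma double_image:
  "double ` {x. double x \<in> blue_red n} = {x \<in> blue_red n. unpaired x = {}}"
proof (intro set_eqI iffI)
  fix x assume "x \<in> double ` {x. double x \<in> blue_red n}"
  then show "x \<in> {x \<in> blue_red n. unpaired x = {}}"
    by (auto simp: double_def unpaired_def)
next
  fix x assume x: "x \<in> {x \<in> blue_red n. unpaired x = {}}"
  obtain B R where BR: "x = (B, R)" by (cases x)
  have "even k" if "k \<in># B" for k using x that by (auto simp: BR unpaired_def)
  then have "image_mset (\<lambda>k. 2 * (k div 2)) B = image_mset (\<lambda>k. k) B"
    by (intro image_mset_cong) auto
  then have B: "B = image_mset ((*) 2) (image_mset (\<lambda>k. k div 2) B)"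
    by (simp add: multiset.map_comp o_def)
  obtain T Q where TQ: "finite T" "R = mset_set T + repeat_mset 2 Q"
    using parity_splitting by blast
  have "even (count R k)" for k
    using x by (cases "k \<in># R") (auto simp: BR unpaired_def blue_red_def not_in_iff)
  then have "T = {}" using odd_count_parity_splitting[of T Q] TQ by auto
  with TQ B have "x = double (image_mset (\<lambda>k. k div 2) B, Q)"
    by (simp add: BR double_def)
  then show "x \<in> double ` {x. double x \<in> blue_red n}" using x by auto
qed

lemma double_in_blue_red_iff:
  "double x \<in> blue_red n \<longleftrightarrow> even n \<and> x \<in> blue_red (n div 2)"
proof -
  obtain B R where BR: "x = (B, R)" by (cases x)
  have "sum_mset (image_mset ((*) 2) B) = 2 * sum_mset B"
    by (induction B) auto
  then have "double x \<in> blue_red n \<longleftrightarrow>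
      set_mset B \<subseteq> {0<..} \<and> set_mset R \<subseteq> Collect odd \<and> 2 * (sum_mset B + sum_mset R) = n"
    by (auto simp: double_def blue_red_def BR sum_mset_repeat_mset set_mset_double
        image_subset_iff)
  moreover have "2 * s = n \<longleftrightarrow> even n \<and> s = n div 2" for s by auto
  ultimately show ?thesis by (auto simp: blue_red_def BR)
qed

lemma card_paired:
  "card {x \<in> blue_red n. unpaired x = {}} = (if even n then card (blue_red (n div 2)) else 0)"
  unfolding double_image[symmetric]
  by (simp add: card_image inj_on_subset[OF inj_double subset_UNIV] double_in_blue_red_iff)

text \<open>The pairs with an unpaired size cancel, and all others have an even number of red parts.\<close>

lemma card_even_red_eq:
  "card {x \<in> blue_red n. even (size (snd x))} =
     card {x \<in> blue_red n. odd (size (snd x))} + card {x \<in> blue_red n. unpaired x = {}}"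
proof -
  have even_if: "even (size (snd x))" if "x \<in> blue_red n" "unpaired x = {}" for x
  proof -
    from that have "x \<in> double ` {x. double x \<in> blue_red n}" by (simp add: double_image)
    then show ?thesis by (auto simp: double_def)
  qed
  have "{x \<in> blue_red n. even (size (snd x))} =
      {x \<in> blue_red n. unpaired x \<noteq> {} \<and> even (size (snd x))} \<union> {x \<in> blue_red n. unpaired x = {}}"
    using even_if by auto
  moreover have "{x \<in> blue_red n. odd (size (snd x))} =
      {x \<in> blue_red n. unpaired x \<noteq> {} \<and> odd (size (snd x))}"
    using even_if by auto
  ultimately show ?thesis
    by (simp add: card_Un_disjoint disjoint_iff finite_blue_red card_unpaired_balanced)
qed

section \<open>The formulas\<close>

lemma overp_of_nat: "overp (of_nat n) = card (blue_red n)"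
  by (simp add: overp_def card_overpartitions)

lemma overp_half:
  "overp (of_nat n / 2) = (if even n then card (blue_red (n div 2)) else 0)"
proof (cases "even n")
  case True
  then obtain m where "n = 2 * m" by blast
  then show ?thesis by (simp add: overp_of_nat)
next
  case False
  have "(of_nat n / 2 :: rat) \<notin> \<nat>"
  proof
    assume "(of_nat n / 2 :: rat) \<in> \<nat>"
    then obtain m where "(of_nat n / 2 :: rat) = of_nat m" by (auto elim: Nats_cases)
    then have "(of_nat n :: rat) = of_nat (2 * m)" by simp
    then have "n = 2 * m" by (simp only: of_nat_eq_iff)
    with False show False by simp
  qed
  then show ?thesis using False by (simp add: overp_def)
qed

theorem theorem5:
  fixes n :: nat
  shows "(of_nat (F\<^sub>0 n) :: rat) =
           (of_nat (overp (of_nat n)) + of_nat (overp (of_nat n / 2))) / 2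
       \<and> (of_nat (F\<^sub>1 n) :: rat) =
           (of_nat (overp (of_nat n)) - of_nat (overp (of_nat n / 2))) / 2"
proof -
  have F0: "F\<^sub>0 n = card {x \<in> blue_red n. even (size (snd x))}"
    unfolding F\<^sub>0_def by (rule card_F_restricted)
  have F1: "F\<^sub>1 n = card {x \<in> blue_red n. odd (size (snd x))}"
    unfolding F\<^sub>1_def by (rule card_F_restricted[of _ "\<lambda>r. odd r"])
  have "F\<^sub>0 n + F\<^sub>1 n = card ({x \<in> blue_red n. even (size (snd x))}
                          \<union> {x \<in> blue_red n. odd (size (snd x))})"
    unfolding F0 F1 by (rule card_Un_disjoint[symmetric]) (auto simp: finite_blue_red)
  also have "\<dots> = overp (of_nat n)"
    unfolding overp_of_nat by (rule arg_cong[of _ _ card]) auto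
  finally have "overp (of_nat n) = F\<^sub>0 n + F\<^sub>1 n" by simp
  moreover have "F\<^sub>0 n = F\<^sub>1 n + overp (of_nat n / 2)"
    unfolding F0 F1 overp_half by (simp only: card_even_red_eq card_paired)
  ultimately show ?thesis by simp
qed

end
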